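(* Let $s(z)$ be a (scalar) rational inner function of degree $n\ge1$, let $s_0(z)=s(z),s_1(z),\dots,s_n(z)$ be the functions produced from $s$ by the Schur algorithm, and let $s_p=s_p(0)$. Let $U$ be a minimal unitary $(n+1)\times(n+1)$ matrix representing $s(z)$, and let $V$ be a unitary $n\times n$ matrix such that $$U^0=\begin{bmatrix}1&0_{1\times n}\\ 0_{n\times1}&V^*\end{bmatrix}U\begin{bmatrix}1&0_{1\times n}\\ 0_{n\times1}&V\end{bmatrix}$$ is a special lower Hessenberg matrix. Define recursively, for $p=0,1,\dots,n-2$, the $(n-p)\times(n-p)$ matrix $U^{p+1}$ from the $(n-p+1)\times(n-p+1)$ matrix $U^p=\begin{bmatrix}A^p&B^p\\ C^p&D^p\end{bmatrix}$ by $$U^{p+1}=\begin{bmatrix}A^{p+1}&B^{p+1}\\ C^{p+1}&D^{p+1}\end{bmatrix}=\begin{bmatrix}(1-|s_p|^2)^{-1/2}C_1^p&D_{12}^p\\ (1-|s_p|^2)^{-1/2}C_2^p&D_{22}^p\end{bmatrix},$$ where $C^p=\begin{bmatrix}C^p_1\\ C^p_2\end{bmatrix}$ and $D^p=\begin{bmatrix}D^p_{11}&D^p_{12}\\ D^p_{21}&D^p_{22}\end{bmatrix}$ with $C_1^p$, $D_{11}^p$ of size $1\times1$ and $D_{22}^p$ of size $(n-1-p)\times(n-1-p)$. Then for every $p=0,1,\dots,n-1$ the matrix $U^p$ is a unitary, HL-non-singular lower Hessenberg matrix, the unitary colligation associated with $U^p$ is minimal, and $U^p$ represents $s_p(z)$: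 $$s_p(z)=A^p+zB^p(I_{n-p}-zD^p)^{-1}C^p.$$ Moreover, $s_n=(1-|s_{n-1}|^2)^{-1/2}C^{n-1}$, where $C^{n-1}$ is the $1\times1$ lower left block of $U^{n-1}$.
   Context: A scalar rational inner function is a rational function, holomorphic in $\{|z|<1\}$, of modulus $\le1$ there and of modulus $1$ on $\{|z|=1\}$; its degree is the maximum of the degrees of numerator and denominator in lowest terms. Schur algorithm: for $s$ rational inner of degree $n$, $s_0(z)=s(z)$ and $$s_{k+1}(z)=\frac1z\,\frac{s_k(z)-s_k}{1-s_k(z)\overline{s_k}},\qquad s_k=s_k(0),\quad k=0,\dots,n-1.$$ Each $s_k(z)$ is rational inner of degree $n-k$; $|s_k|<1$ for $k<n$, $|s_n|=1$ and $s_n(z)\equiv s_n$. The numbers $s_k$ are the Schur parameters of $s$. (The symbol $s_k(z)$ denotes a function, $s_k$ the number $s_k(0)$.) A square matrix of size $(m+1)\times(m+1)$ is partitioned as $W=\begin{bmatrix}A&B\\ C&D\end{bmatrix}$ with $A$ of size $1\times1$ and $D$ of size $m\times m$; a unitary $W$ represents the function $A+zB(I_m-zD)^{-1}C$. The unitary matrix $W$ (equivalently, its associated unitary colligation) is minimal if both $[C\ \ DC\ \cdots\ D^{m-1}C]$ and $[B^*\ \ D^*B^*\ \cdots\ (D^* )^{m-1}B^*]$ have rank $m$. A square matrix $H=\|h_{jk}\|_{0\le j,k\le m}$ is lower Hessenberg if $h_{jk}=0$ whenever $k>j+1$; it is special if $h_{j,j+1}\ge0$ for $0\le j\le m-1$;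 it is HL-non-singular if $h_{j,j+1}\ne0$ for $0\le j\le m-1$. *)

theory Defs
  imports
    "HOL-Analysis.Complex_Analysis_Basics"
    "HOL-Computational_Algebra.Polynomial_Factorial"
    "HOL-Computational_Algebra.Field_as_Ring"
    "Jordan_Normal_Form.DL_Rank"
    "Jordan_Normal_Form.Gauss_Jordan_Elimination"
    "Jordan_Normal_Form.Schur_Decomposition"
begin

(* Rational functions are elements of the field of fractions of complex polynomials;
   quot_of_fract returns the numerator and denominator in lowest terms. *)
type_synonym ratfun = "complex poly fract"

(* The value at a pole is 0 by convention (division by zero). *)
definition ratfun_eval :: "ratfun \<Rightarrow> complex \<Rightarrow> complex" where
  "ratfun_eval f z = (case quot_of_fract f of (p, q) \<Rightarrow> poly p z / poly q z)"

definition ratfun_degree :: "ratfun \<Rightarrow> nat" where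
  "ratfun_degree f = (case quot_of_fract f of (p, q) \<Rightarrow> max (degree p) (degree q))"

definition ratfun_const :: "complex \<Rightarrow> ratfun" where
  "ratfun_const c = to_fract [:c:]"

definition ratfun_id :: ratfun where
  "ratfun_id = to_fract [:0, 1:]"

(* The convention at poles is harmless here: a pole in the open disc makes ratfun_eval f
   discontinuous there, and a pole on the circle gives modulus 0 instead of 1. *)
definition rational_inner :: "ratfun \<Rightarrow> bool" where
  "rational_inner f \<longleftrightarrow>
     ratfun_eval f holomorphic_on ball 0 1 \<and>
     (\<forall>z. cmod z < 1 \<longrightarrow> cmod (ratfun_eval f z) \<le> 1) \<and>
     (\<forall>z. cmod z = 1 \<longrightarrow> cmod (ratfun_eval f z) = 1)"

definition schur_step :: "ratfun \<Rightarrow> ratfun" where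
  "schur_step f =
     (let c = ratfun_eval f 0
      in (1 / ratfun_id) * ((f - ratfun_const c) / (1 - f * ratfun_const (cnj c))))"

definition schur_fun :: "ratfun \<Rightarrow> nat \<Rightarrow> ratfun" where
  "schur_fun s k = (schur_step ^^ k) s"

definition schur_param :: "ratfun \<Rightarrow> nat \<Rightarrow> complex" where
  "schur_param s k = ratfun_eval (schur_fun s k) 0"

definition unitary_mat :: "complex mat \<Rightarrow> bool" where
  "unitary_mat W \<longleftrightarrow>
     square_mat W \<and>
     W * mat_adjoint W = 1\<^sub>m (dim_row W) \<and> mat_adjoint W * W = 1\<^sub>m (dim_row W)"

(* As an identity of rational functions: det (I - z D) is a polynomial in z with value 1 at
   z = 0, so only finitely many z are excluded, and none of them lies in the open unit disc
   when W is unitary, since D is then a contraction. *)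
definition represents :: "complex mat \<Rightarrow> ratfun \<Rightarrow> bool" where
  "represents W f \<longleftrightarrow>
     (case split_block W 1 1 of (A, B, C, D) \<Rightarrow>
       \<forall>z. invertible_mat (1\<^sub>m (dim_row D) - z \<cdot>\<^sub>m D) \<longrightarrow>
         ratfun_eval f z =
           (A + z \<cdot>\<^sub>m (B * the (mat_inverse (1\<^sub>m (dim_row D) - z \<cdot>\<^sub>m D)) * C)) $$ (0, 0))"

(* [C, D C, ..., D^(m-1) C] for an m x m matrix D and a column C. *)
definition krylov_mat :: "complex mat \<Rightarrow> complex mat \<Rightarrow> complex mat" where
  "krylov_mat D C =
     mat_of_cols (dim_row D) (map (\<lambda>j. col (D ^\<^sub>m j * C) 0) [0..<dim_row D])"

definition minimal_mat :: "complex mat \<Rightarrow> bool" where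
  "minimal_mat W \<longleftrightarrow>
     (case split_block W 1 1 of (A, B, C, D) \<Rightarrow>
       vec_space.rank (dim_row D) (krylov_mat D C) = dim_row D \<and>
       vec_space.rank (dim_row D) (krylov_mat (mat_adjoint D) (mat_adjoint B)) = dim_row D)"

definition lower_hessenberg :: "complex mat \<Rightarrow> bool" where
  "lower_hessenberg H \<longleftrightarrow>
     square_mat H \<and>
     (\<forall>j k. j < dim_row H \<and> k < dim_row H \<and> k > j + 1 \<longrightarrow> H $$ (j, k) = 0)"

(* The order on complex numbers: 0 \<le> h means that h is real and nonnegative. *)
definition special_hessenberg :: "complex mat \<Rightarrow> bool" where
  "special_hessenberg H \<longleftrightarrow> (\<forall>j. j + 1 < dim_row H \<longrightarrow> 0 \<le> H $$ (j, j + 1))"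

definition HL_nonsingular :: "complex mat \<Rightarrow> bool" where
  "HL_nonsingular H \<longleftrightarrow> (\<forall>j. j + 1 < dim_row H \<longrightarrow> H $$ (j, j + 1) \<noteq> 0)"

definition schur_factor :: "complex \<Rightarrow> complex" where
  "schur_factor c = complex_of_real ((1 - (cmod c)\<^sup>2) powr (- 1 / 2))"

(* The passage from U^p to U^(p+1), with c the Schur parameter s_p. C has one column, so
   splitting it after its first column leaves empty right-hand blocks. *)
definition colligation_step :: "complex \<Rightarrow> complex mat \<Rightarrow> complex mat" where
  "colligation_step c W =
     (case split_block W 1 1 of (A, B, C, D) \<Rightarrow>
      case split_block C 1 1 of (C1, _, C2, _) \<Rightarrow>
      case split_block D 1 1 of (D11, D12, D21, D22) \<Rightarrow>
        four_block_mat (schur_factor c \<cdot>\<^sub>m C1) D12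
                       (schur_factor c \<cdot>\<^sub>m C2) D22)"

end

theory Submission
  imports Defs
begin

text \<open>
  Attach to a colligation \<open>W = [A, B; C, D]\<close> the two polynomials
  \<open>den(z) = det (I - z D)\<close> and \<open>num(z) = det [A, - z B; C, I - z D]\<close>. A Schur complement gives
  \<open>A + z B (I - z D)\<^sup>-\<^sup>1 C = num(z) / den(z)\<close>, so \<open>W\<close> represents \<open>f\<close> exactly when
  \<open>f = num / den\<close> as rational functions (\<open>represents_iff_fract\<close>).

  If \<open>W\<close> is unitary and special lower Hessenberg, its first row is \<open>(c, b, 0, \<dots>, 0)\<close> with
  \<open>b \<ge> 0\<close> and \<open>|c|\<^sup>2 + b\<^sup>2 = 1\<close>. When \<open>b \<noteq> 0\<close>, orthogonality of the other rows to this one makes the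
  second column of \<open>W\<close>, below the first row, equal to \<open>- cnj c / b\<close> times the first column.
  Linearity of the determinant in one column and expansion along the first row then give, for the
  reduced colligation \<open>W'\<close> with polynomials \<open>num'\<close> and \<open>den'\<close>,
  \<open>den = den' + z cnj c num'\<close> and \<open>num = c den' + z num'\<close> (\<open>poly_step\<close>). Solving for
  \<open>num' / den'\<close> is exactly the Schur step, so \<open>W'\<close> represents the next Schur function. The columns of
  \<open>W'\<close> are orthonormal because those of \<open>W\<close> are, and the superdiagonal of \<open>W'\<close> is the superdiagonal
  of \<open>W\<close> without its first entry.

  Minimality of a unitary lower Hessenberg matrix is the same as HL-non-singularity
  (\<open>minimal_hessenberg_iff\<close>). The Krylov matrix of \<open>(D\<^sup>*, B\<^sup>*)\<close> is upper triangular, with products of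
  the conjugated superdiagonal entries on its diagonal. The Krylov matrix of \<open>(D, C)\<close> is non-singular
  together with it: by telescoping, the Gram matrices of the two are \<open>I - D\<^sup>*\<^sup>m D\<^sup>m\<close> and
  \<open>I - D\<^sup>m D\<^sup>*\<^sup>m\<close>, and \<open>I - X Y\<close> is singular exactly when \<open>I - Y X\<close> is. Hence minimality of \<open>U\<close>, which is
  unaffected by the change of basis \<open>V\<close>, makes every superdiagonal entry of \<open>Us 0\<close> non-zero, and all
  claims propagate along the recursion.
\<close>

section \<open>Adjoints and unitary matrices\<close>

lemma mat_adjoint_carrier [simp]:
  "A \<in> carrier_mat n m \<Longrightarrow> mat_adjoint A \<in> carrier_mat m n"
  unfolding mat_adjoint_def by (auto simp: mat_of_rows_def)

lemma dim_mat_adjoint [simp]: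
  "dim_row (mat_adjoint A) = dim_col A" "dim_col (mat_adjoint A) = dim_row A"
  unfolding mat_adjoint_def by (auto simp: mat_of_rows_def)

lemma mat_adjoint_index [simp]:
  fixes A :: "complex mat"
  assumes "i < dim_col A" "j < dim_row A"
  shows "mat_adjoint A $$ (i, j) = cnj (A $$ (j, i))"
  using assms unfolding mat_adjoint_def by (simp add: mat_of_rows_def)

lemma mat_adjoint_adjoint [simp]:
  fixes A :: "complex mat"
  shows "mat_adjoint (mat_adjoint A) = A"
  by (rule eq_matI) auto

lemma mat_adjoint_mult:
  fixes A B :: "complex mat"
  assumes "A \<in> carrier_mat n m" "B \<in> carrier_mat m l"
  shows "mat_adjoint (A * B) = mat_adjoint B * mat_adjoint A"
  using assms by (intro eq_matI) (auto simp: scalar_prod_def intro!: sum.cong)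

lemma mat_adjoint_one [simp]: "mat_adjoint (1\<^sub>m n :: complex mat) = 1\<^sub>m n"
  by (rule eq_matI) auto

lemma pow_mat_Suc_left:
  fixes A :: "'a :: semiring_1 mat"
  assumes "A \<in> carrier_mat n n"
  shows "A ^\<^sub>m Suc k = A * A ^\<^sub>m k"
proof (induction k)
  case 0
  then show ?case using assms by simp
next
  case (Suc k)
  have "A ^\<^sub>m Suc (Suc k) = (A * A ^\<^sub>m k) * A" using Suc by simp
  also have "\<dots> = A * A ^\<^sub>m Suc k" using assms by (simp add: assoc_mult_mat[of _ n n _ n _ n])
  finally show ?case .
qed

lemma mat_adjoint_pow:
  fixes A :: "complex mat"
  assumes "A \<in> carrier_mat n n"
  shows "mat_adjoint (A ^\<^sub>m k) = mat_adjoint A ^\<^sub>m k"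
proof (induction k)
  case 0
  then show ?case using assms by simp
next
  case (Suc k)
  have "mat_adjoint (A ^\<^sub>m Suc k) = mat_adjoint A * mat_adjoint A ^\<^sub>m k"
    using assms Suc by (simp add: mat_adjoint_mult[of _ n n _ n])
  also have "\<dots> = mat_adjoint A ^\<^sub>m Suc k"
    using assms by (intro pow_mat_Suc_left[symmetric, of _ n]) simp
  finally show ?case .
qed

lemma mult_adjoint_index:
  fixes A :: "complex mat"
  assumes "A \<in> carrier_mat n m" "i < n" "j < n"
  shows "(A * mat_adjoint A) $$ (i, j) = (\<Sum>k<m. A $$ (i, k) * cnj (A $$ (j, k)))"
  using assms by (auto simp: scalar_prod_def atLeast0LessThan intro!: sum.cong)

lemma adjoint_mult_index:
  fixes A :: "complex mat"
  assumes "A \<in> carrier_mat n m" "i < m" "j < m"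
  shows "(mat_adjoint A * A) $$ (i, j) = (\<Sum>k<n. cnj (A $$ (k, i)) * A $$ (k, j))"
  using assms by (auto simp: scalar_prod_def atLeast0LessThan intro!: sum.cong)

lemma unitary_mat_rows:
  assumes "W \<in> carrier_mat n n" "unitary_mat W" "i < n" "j < n"
  shows "(\<Sum>k<n. W $$ (i, k) * cnj (W $$ (j, k))) = (if i = j then 1 else 0)"
  using assms mult_adjoint_index[of W n n i j] by (auto simp: unitary_mat_def)

lemma unitary_mat_cols:
  assumes "W \<in> carrier_mat n n" "unitary_mat W" "i < n" "j < n"
  shows "(\<Sum>k<n. cnj (W $$ (k, i)) * W $$ (k, j)) = (if i = j then 1 else 0)"
  using assms adjoint_mult_index[of W n n i j] by (auto simp: unitary_mat_def)

lemma unitary_matI_cols: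
  assumes W: "W \<in> carrier_mat n n"
    and orth: "\<And>i j. i < n \<Longrightarrow> j < n \<Longrightarrow>
      (\<Sum>k<n. cnj (W $$ (k, i)) * W $$ (k, j)) = (if i = j then 1 else 0)"
  shows "unitary_mat W"
proof -
  have 1: "mat_adjoint W * W = 1\<^sub>m n"
    using W by (intro eq_matI) (auto simp: adjoint_mult_index[OF W] orth simp del: index_mult_mat(1))
  moreover have "W * mat_adjoint W = 1\<^sub>m n"
    by (rule mat_mult_left_right_inverse[OF _ W 1]) (use W in simp)
  ultimately show ?thesis
    using W by (simp add: unitary_mat_def)
qed

lemma unitary_mat_inverse:
  assumes "V \<in> carrier_mat n n" "unitary_mat V"
  shows "mat_adjoint V * V = 1\<^sub>m n" "V * mat_adjoint V = 1\<^sub>m n"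
  using assms by (auto simp: unitary_mat_def)

lemma unitary_mat_adjoint:
  "unitary_mat V \<Longrightarrow> unitary_mat (mat_adjoint V)"
  by (auto simp: unitary_mat_def)

lemma unitary_mat_mult:
  assumes V: "V \<in> carrier_mat n n" "unitary_mat V" and W: "W \<in> carrier_mat n n" "unitary_mat W"
  shows "unitary_mat (V * W)"
proof -
  have "(V * W) * mat_adjoint (V * W) = V * (W * mat_adjoint W) * mat_adjoint V"
    using V W by (simp add: mat_adjoint_mult[of _ n n _ n] assoc_mult_mat[of _ n n _ n _ n]
        mult_carrier_mat[of _ n n _ n])
  also have "\<dots> = 1\<^sub>m n"
    using V W unitary_mat_inverse by simp
  finally have 1: "(V * W) * mat_adjoint (V * W) = 1\<^sub>m n" .
  have "mat_adjoint (V * W) * (V * W) = mat_adjoint W * ((mat_adjoint V * V) * W)"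
    using V W by (simp add: mat_adjoint_mult[of _ n n _ n] assoc_mult_mat[of _ n n _ n _ n]
        mult_carrier_mat[of _ n n _ n])
  also have "\<dots> = 1\<^sub>m n"
    using V W unitary_mat_inverse by simp
  finally show ?thesis using 1 V W by (auto simp: unitary_mat_def)
qed

section \<open>Blocks of a colligation\<close>

text \<open>
  For a colligation \<open>W = [A, B; C, D]\<close> with a \<open>1 \<times> 1\<close> block \<open>A\<close>, the three functions below extract
  \<open>B\<close> (state to output), \<open>C\<close> (input to state) and \<open>D\<close> (state to state).
\<close>

definition out_block :: "complex mat \<Rightarrow> complex mat" where
  "out_block W = mat 1 (dim_col W - 1) (\<lambda>(i, j). W $$ (i, Suc j))"

definition in_block :: "complex mat \<Rightarrow> complex mat" where
  "in_block W = mat (dim_row W - 1) 1 (\<lambda>(i, j). W $$ (Suc i, j))"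

definition state_block :: "complex mat \<Rightarrow> complex mat" where
  "state_block W = mat (dim_row W - 1) (dim_col W - 1) (\<lambda>(i, j). W $$ (Suc i, Suc j))"

lemma split_block_eq:
  "split_block W 1 1 = (mat 1 1 (\<lambda>ij. W $$ ij), out_block W, in_block W, state_block W)"
  by (simp add: split_block_def Let_def out_block_def in_block_def state_block_def)

lemma split_block_eq_Suc [simp]:
  "split_block W (Suc 0) (Suc 0) = (mat 1 1 (\<lambda>ij. W $$ ij), out_block W, in_block W, state_block W)"
  using split_block_eq by simp

lemma block_dims [simp]:
  "dim_row (out_block W) = 1" "dim_col (out_block W) = dim_col W - 1"
  "dim_row (in_block W) = dim_row W - 1" "dim_col (in_block W) = 1"
  "dim_row (state_block W) = dim_row W - 1" "dim_col (state_block W) = dim_col W - 1"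
  by (simp_all add: out_block_def in_block_def state_block_def)

lemma block_carriers [simp]:
  assumes "W \<in> carrier_mat (Suc m) (Suc m)"
  shows "out_block W \<in> carrier_mat 1 m" "in_block W \<in> carrier_mat m 1"
    "state_block W \<in> carrier_mat m m"
  using assms by (auto simp: out_block_def in_block_def state_block_def)

lemma block_index [simp]:
  assumes "W \<in> carrier_mat (Suc m) (Suc m)" "i < m" "j < m"
  shows "out_block W $$ (0, j) = W $$ (0, Suc j)" "in_block W $$ (i, 0) = W $$ (Suc i, 0)"
    "state_block W $$ (i, j) = W $$ (Suc i, Suc j)"
  using assms by (auto simp: out_block_def in_block_def state_block_def)

lemma unitary_blocks:
  assumes W: "W \<in> carrier_mat (Suc m) (Suc m)" "unitary_mat W"
  shows "in_block W * mat_adjoint (in_block W) = 1\<^sub>m m - state_block W * mat_adjoint (state_block W)"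
    and "mat_adjoint (out_block W) * out_block W = 1\<^sub>m m - mat_adjoint (state_block W) * state_block W"
proof -
  note c = block_carriers[OF W(1)]
  show "in_block W * mat_adjoint (in_block W) = 1\<^sub>m m - state_block W * mat_adjoint (state_block W)"
  proof (rule eq_matI, goal_cases)
    case (1 i j)
    then have ij: "i < m" "j < m" using c by auto
    have "(in_block W * mat_adjoint (in_block W)) $$ (i, j)
        + (state_block W * mat_adjoint (state_block W)) $$ (i, j) = (if i = j then 1 else 0)"
      using unitary_mat_rows[OF W, of "Suc i" "Suc j"] ij W
      by (simp add: mult_adjoint_index[OF c(2)] mult_adjoint_index[OF c(3)] sum.lessThan_Suc_shift
          del: index_mult_mat(1) sum.lessThan_Suc)
    then show ?case using ij W by (simp add: algebra_simps del: index_mult_mat(1))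
  qed (use c in auto)
  show "mat_adjoint (out_block W) * out_block W = 1\<^sub>m m - mat_adjoint (state_block W) * state_block W"
  proof (rule eq_matI, goal_cases)
    case (1 i j)
    then have ij: "i < m" "j < m" using c by auto
    have "(mat_adjoint (out_block W) * out_block W) $$ (i, j)
        + (mat_adjoint (state_block W) * state_block W) $$ (i, j) = (if i = j then 1 else 0)"
      using unitary_mat_cols[OF W, of "Suc i" "Suc j"] ij W
      by (simp add: adjoint_mult_index[OF c(1)] adjoint_mult_index[OF c(3)] sum.lessThan_Suc_shift
          del: index_mult_mat(1) sum.lessThan_Suc)
    then show ?case using ij W by (simp add: algebra_simps del: index_mult_mat(1))
  qed (use c in auto)
qed

section \<open>Krylov matrices and minimality\<close>

lemma krylov_mat_carrier:
  "D \<in> carrier_mat m m \<Longrightarrow> krylov_mat D C \<in> carrier_mat m m"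
  by (auto simp: krylov_mat_def)

lemma krylov_mat_index:
  assumes "D \<in> carrier_mat m m" "C \<in> carrier_mat m 1" "i < m" "j < m"
  shows "krylov_mat D C $$ (i, j) = (D ^\<^sub>m j * C) $$ (i, 0)"
  using assms by (auto simp: krylov_mat_def mat_of_cols_def)

text \<open>
  Under the Stein equation \<open>C C\<^sup>* = I - D D\<^sup>*\<close>, the Gram matrix \<open>\<Sum>\<^sub>j D\<^sup>j C C\<^sup>* D\<^sup>*\<^sup>j\<close> telescopes.
\<close>

lemma krylov_gram:
  assumes D: "D \<in> carrier_mat m m" and C: "C \<in> carrier_mat m 1"
    and stein: "C * mat_adjoint C = 1\<^sub>m m - D * mat_adjoint D"
  shows "krylov_mat D C * mat_adjoint (krylov_mat D C) = 1\<^sub>m m - D ^\<^sub>m m * mat_adjoint (D ^\<^sub>m m)"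
proof -
  define S where "S j = D ^\<^sub>m j * mat_adjoint (D ^\<^sub>m j)" for j
  have Sc: "S j \<in> carrier_mat m m" for j using D by (simp add: S_def mult_carrier_mat[of _ m m _ m])
  have tele: "(D ^\<^sub>m j * C) * mat_adjoint (D ^\<^sub>m j * C) = S j - S (Suc j)" for j
  proof -
    let ?P = "D ^\<^sub>m j"
    have P: "?P \<in> carrier_mat m m" using D by simp
    have "(?P * C) * mat_adjoint (?P * C) = ?P * (C * mat_adjoint C) * mat_adjoint ?P"
    proof -
      have P': "mat_adjoint ?P \<in> carrier_mat m m" and C': "mat_adjoint C \<in> carrier_mat 1 m"
        using P C by auto
      have "(?P * C) * (mat_adjoint C * mat_adjoint ?P) = ?P * (C * (mat_adjoint C * mat_adjoint ?P))"
        by (rule assoc_mult_mat[OF P C mult_carrier_mat[OF C' P']])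
      also have "C * (mat_adjoint C * mat_adjoint ?P) = (C * mat_adjoint C) * mat_adjoint ?P"
        by (rule assoc_mult_mat[OF C C' P', symmetric])
      also have "?P * \<dots> = ?P * (C * mat_adjoint C) * mat_adjoint ?P"
        by (rule assoc_mult_mat[OF P mult_carrier_mat[OF C C'] P', symmetric])
      finally show ?thesis by (simp only: mat_adjoint_mult[OF P C])
    qed
    also have "\<dots> = (?P - ?P * (D * mat_adjoint D)) * mat_adjoint ?P"
      using P D by (simp add: stein mult_minus_distrib_mat[of _ m m _ m])
    also have "\<dots> = S j - ?P * (D * mat_adjoint D) * mat_adjoint ?P"
      using P D by (simp add: S_def minus_mult_distrib_mat[of _ m m _ _ m] mult_carrier_mat[of _ m m _ m])
    also have "?P * (D * mat_adjoint D) * mat_adjoint ?P = S (Suc j)"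
      using P D by (simp add: S_def mat_adjoint_mult[OF P D] assoc_mult_mat[of _ m m _ m _ m]
          mult_carrier_mat[of _ m m _ m])
    finally show ?thesis .
  qed
  have K: "krylov_mat D C \<in> carrier_mat m m" by (rule krylov_mat_carrier[OF D])
  have "krylov_mat D C * mat_adjoint (krylov_mat D C) = S 0 - S m"
  proof (rule eq_matI, goal_cases)
    case (1 a b)
    then have ab: "a < m" "b < m" using Sc[of m] by auto
    have "(krylov_mat D C * mat_adjoint (krylov_mat D C)) $$ (a, b)
        = (\<Sum>j<m. (D ^\<^sub>m j * C) $$ (a, 0) * cnj ((D ^\<^sub>m j * C) $$ (b, 0)))"
      using ab by (simp add: mult_adjoint_index[OF K] krylov_mat_index[OF D C] del: index_mult_mat(1))
    also have "\<dots> = (\<Sum>j<m. ((D ^\<^sub>m j * C) * mat_adjoint (D ^\<^sub>m j * C)) $$ (a, b))"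
    proof (rule sum.cong[OF refl])
      fix j
      have "D ^\<^sub>m j * C \<in> carrier_mat m 1" using D C by auto
      from mult_adjoint_index[OF this ab]
      show "(D ^\<^sub>m j * C) $$ (a, 0) * cnj ((D ^\<^sub>m j * C) $$ (b, 0))
          = ((D ^\<^sub>m j * C) * mat_adjoint (D ^\<^sub>m j * C)) $$ (a, b)" by simp
    qed
    also have "\<dots> = (\<Sum>j<m. S j $$ (a, b) - S (Suc j) $$ (a, b))"
      using ab by (simp add: tele carrier_matD[OF Sc] del: index_mult_mat(1))
    also have "\<dots> = S 0 $$ (a, b) - S m $$ (a, b)" by (rule sum_lessThan_telescope')
    finally show ?case using ab Sc[of m] by simp
  qed (use K Sc[of m] in auto)
  then show ?thesis using D by (simp add: S_def)
qed

lemma det_one_minus_mult_zero: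
  fixes X Y :: "'a :: idom mat"
  assumes X: "X \<in> carrier_mat m m" and Y: "Y \<in> carrier_mat m m"
    and "det (1\<^sub>m m - X * Y) = 0"
  shows "det (1\<^sub>m m - Y * X) = 0"
proof -
  obtain v where v: "v \<in> carrier_vec m" "v \<noteq> 0\<^sub>v m" "(1\<^sub>m m - X * Y) *\<^sub>v v = 0\<^sub>v m"
    using assms det_0_iff_vec_prod_zero[of "1\<^sub>m m - X * Y" m] by (auto simp: minus_carrier_mat)
  have fixed: "(X * Y) *\<^sub>v v = v"
  proof -
    have "v - (X * Y) *\<^sub>v v = 0\<^sub>v m"
      using v X Y by (simp add: minus_mult_distrib_mat_vec[of _ m m])
    show ?thesis
    proof (rule eq_vecI, goal_cases)
      case (1 i)
      have "(v - (X * Y) *\<^sub>v v) $ i = 0" using \<open>v - _ = _\<close> 1 v by simp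
      then show ?case using 1 v X Y by (simp del: index_mult_mat_vec)
    qed (use v X in auto)
  qed
  define w where "w = Y *\<^sub>v v"
  have w: "w \<in> carrier_vec m" using Y v by (simp add: w_def)
  have Xw: "X *\<^sub>v w = v" using fixed X Y v by (simp add: w_def assoc_mult_mat_vec[of _ m m _ m])
  have "w \<noteq> 0\<^sub>v m"
  proof
    assume "w = 0\<^sub>v m"
    then have "v = 0\<^sub>v m" using Xw X by auto
    then show False using v by simp
  qed
  moreover have "(1\<^sub>m m - Y * X) *\<^sub>v w = 0\<^sub>v m"
  proof -
    have "(1\<^sub>m m - Y * X) *\<^sub>v w = w - Y *\<^sub>v (X *\<^sub>v w)"
      using w X Y by (simp add: minus_mult_distrib_mat_vec[of _ m m] assoc_mult_mat_vec[of _ m m _ m])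
    also have "\<dots> = 0\<^sub>v m"
      unfolding Xw using w by (simp add: w_def[symmetric])
    finally show ?thesis .
  qed
  ultimately show ?thesis
    using w X Y by (subst det_0_iff_vec_prod_zero[of _ m]) auto
qed

lemma det_adjoint_zero:
  fixes A :: "complex mat"
  assumes A: "A \<in> carrier_mat n n"
  shows "det (A * mat_adjoint A) = 0 \<longleftrightarrow> det A = 0"
proof -
  interpret c: comm_ring_hom cnj by unfold_locales auto
  have "mat_adjoint A = (map_mat cnj A)\<^sup>T" using A by (intro eq_matI) auto
  then have "det (mat_adjoint A) = cnj (det A)"
    using A by (simp add: det_transpose[of _ n])
  then show ?thesis using A by (simp add: det_mult[of _ n])
qed

text \<open>
  A unitary colligation with finite-dimensional state space is controllable if and only if it is
  observable.
\<close>

lemma krylov_controllable_iff_observable: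
  assumes W: "W \<in> carrier_mat (Suc m) (Suc m)" "unitary_mat W"
  shows "det (krylov_mat (state_block W) (in_block W)) = 0 \<longleftrightarrow>
    det (krylov_mat (mat_adjoint (state_block W)) (mat_adjoint (out_block W))) = 0"
proof -
  let ?D = "state_block W" and ?C = "in_block W" and ?B = "out_block W"
  note c = block_carriers[OF W(1)]
  let ?X = "?D ^\<^sub>m m" and ?Y = "mat_adjoint ?D ^\<^sub>m m"
  have XY: "?X \<in> carrier_mat m m" "?Y \<in> carrier_mat m m" "mat_adjoint ?X = ?Y" "mat_adjoint ?Y = ?X"
    using c by (auto simp: mat_adjoint_pow[of _ m])
  have 1: "krylov_mat ?D ?C * mat_adjoint (krylov_mat ?D ?C) = 1\<^sub>m m - ?X * ?Y"
    using krylov_gram[OF c(3,2) unitary_blocks(1)[OF W]] XY by simp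
  have 2: "krylov_mat (mat_adjoint ?D) (mat_adjoint ?B)
      * mat_adjoint (krylov_mat (mat_adjoint ?D) (mat_adjoint ?B)) = 1\<^sub>m m - ?Y * ?X"
    using krylov_gram[of "mat_adjoint ?D" m "mat_adjoint ?B"] unitary_blocks(2)[OF W] XY c by simp
  have "det (krylov_mat ?D ?C) = 0 \<longleftrightarrow> det (1\<^sub>m m - ?X * ?Y) = 0"
    using det_adjoint_zero[OF krylov_mat_carrier[OF c(3), of ?C]] 1 by simp
  also have "\<dots> \<longleftrightarrow> det (1\<^sub>m m - ?Y * ?X) = 0"
    using XY det_one_minus_mult_zero by blast
  also have "\<dots> \<longleftrightarrow> det (krylov_mat (mat_adjoint ?D) (mat_adjoint ?B)) = 0"
    using det_adjoint_zero[OF krylov_mat_carrier[of "mat_adjoint ?D" m "mat_adjoint ?B"]] 2 c by simp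
  finally show ?thesis .
qed

lemma minimal_unitary_iff:
  assumes W: "W \<in> carrier_mat (Suc m) (Suc m)" "unitary_mat W"
  shows "minimal_mat W \<longleftrightarrow>
    det (krylov_mat (mat_adjoint (state_block W)) (mat_adjoint (out_block W))) \<noteq> 0"
proof -
  note c = block_carriers[OF W(1)]
  have "dim_row (state_block W) = m" using c by auto
  then show ?thesis
    using krylov_controllable_iff_observable[OF W] c
    by (simp add: minimal_mat_def krylov_mat_carrier
        flip: vec_space.det_rank_iff)
qed

text \<open>
  For a lower Hessenberg \<open>W\<close> the Krylov matrix of \<open>(D\<^sup>*, B\<^sup>*)\<close> is upper triangular: \<open>B\<^sup>*\<close> is a multiple
  of the first unit vector and \<open>D\<^sup>*\<close> is upper Hessenberg.
\<close>

lemma hessenberg_krylov_entry: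
  assumes W: "W \<in> carrier_mat (Suc m) (Suc m)" "lower_hessenberg W"
    and "i < m" "j < m" "j \<le> i"
  shows "(mat_adjoint (state_block W) ^\<^sub>m j * mat_adjoint (out_block W)) $$ (i, 0)
    = (if i = j then \<Prod>k\<le>j. cnj (W $$ (k, Suc k)) else 0)"
  using assms(3-)
proof (induction j arbitrary: i)
  case 0
  note c = block_carriers[OF W(1)]
  have "mat_adjoint (state_block W) ^\<^sub>m 0 * mat_adjoint (out_block W) = mat_adjoint (out_block W)"
    using c by simp
  moreover have "W $$ (0, Suc i) = 0" if "i \<noteq> 0"
    using W 0 that by (auto simp: lower_hessenberg_def)
  ultimately show ?case
    using c 0 W by (auto simp del: pow_mat.simps index_mult_mat(1))
next
  case (Suc j)
  note c = block_carriers[OF W(1)]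
  let ?A = "mat_adjoint (state_block W)" and ?b = "mat_adjoint (out_block W)"
  let ?x = "?A ^\<^sub>m j * ?b"
  have A: "?A \<in> carrier_mat m m" and b: "?b \<in> carrier_mat m 1" using c by auto
  have x: "?x \<in> carrier_mat m 1" using A b by (intro mult_carrier_mat[of _ m m]) auto
  have "?A ^\<^sub>m Suc j * ?b = ?A * ?x"
    using A b by (simp add: pow_mat_Suc_left[OF A] assoc_mult_mat[of _ m m _ m _ 1] del: pow_mat.simps)
  then have "(?A ^\<^sub>m Suc j * ?b) $$ (i, 0) = scalar_prod (Matrix.row ?A i) (col ?x 0)"
    using Suc.prems A x by (simp only: index_mult_mat(1) carrier_matD)
  also have "\<dots> = (\<Sum>k<m. ?A $$ (i, k) * ?x $$ (k, 0))"
    using Suc.prems A x W(1) unfolding scalar_prod_def atLeast0LessThan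
    by (intro sum.cong) (auto simp del: index_mult_mat(1))
  also have "\<dots> = (\<Sum>k<m. cnj (W $$ (Suc k, Suc i)) * ?x $$ (k, 0))"
    using Suc.prems c W by (intro sum.cong) (auto simp del: index_mult_mat(1))
  also have "\<dots> = (\<Sum>k<m. if k = j then cnj (W $$ (Suc j, Suc i)) * (\<Prod>k\<le>j. cnj (W $$ (k, Suc k))) else 0)"
  proof (rule sum.cong[OF refl])
    fix k assume k: "k \<in> {..<m}"
    show "cnj (W $$ (Suc k, Suc i)) * ?x $$ (k, 0)
      = (if k = j then cnj (W $$ (Suc j, Suc i)) * (\<Prod>k\<le>j. cnj (W $$ (k, Suc k))) else 0)"
    proof (cases "k < j")
      case True
      then have "W $$ (Suc k, Suc i) = 0"
        using W Suc.prems by (auto simp: lower_hessenberg_def)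
      then show ?thesis using True by simp
    next
      case False
      then show ?thesis using Suc.IH[of k] k Suc.prems by (simp del: index_mult_mat(1))
    qed
  qed
  also have "\<dots> = cnj (W $$ (Suc j, Suc i)) * (\<Prod>k\<le>j. cnj (W $$ (k, Suc k)))"
    using Suc.prems by simp
  also have "\<dots> = (if i = Suc j then \<Prod>k\<le>Suc j. cnj (W $$ (k, Suc k)) else 0)"
    using W Suc.prems by (auto simp: lower_hessenberg_def)
  finally show ?case .
qed

lemma minimal_hessenberg_iff:
  assumes W: "W \<in> carrier_mat (Suc m) (Suc m)" "unitary_mat W" "lower_hessenberg W"
  shows "minimal_mat W \<longleftrightarrow> HL_nonsingular W"
proof -
  note c = block_carriers[OF W(1)]
  let ?K = "krylov_mat (mat_adjoint (state_block W)) (mat_adjoint (out_block W))"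
  have K: "?K \<in> carrier_mat m m" using c by (intro krylov_mat_carrier) auto
  have entry: "?K $$ (i, j) = (if i = j then \<Prod>k\<le>j. cnj (W $$ (k, Suc k)) else 0)"
    if "i < m" "j \<le> i" for i j
    using that c hessenberg_krylov_entry[OF W(1,3), of i j]
    by (simp add: krylov_mat_index[of _ m] del: index_mult_mat(1))
  have "upper_triangular ?K" using K entry by auto
  then have "det ?K = prod_list (diag_mat ?K)" by (rule det_upper_triangular[OF _ K])
  also have "\<dots> = (\<Prod>i<m. \<Prod>k\<le>i. cnj (W $$ (k, Suc k)))"
    using K entry by (simp add: prod_list_diag_prod atLeast0LessThan)
  finally have "det ?K \<noteq> 0 \<longleftrightarrow> (\<forall>i<m. \<forall>k\<le>i. W $$ (k, Suc k) \<noteq> 0)" by auto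
  also have "\<dots> \<longleftrightarrow> HL_nonsingular W"
    using W(1) by (auto simp: HL_nonsingular_def)
  finally show ?thesis using minimal_unitary_iff[OF W(1,2)] by simp
qed

section \<open>Transfer functions as quotients of polynomials\<close>

text \<open>
  \<open>pencil W z\<close> is \<open>[A, - z B; C, I - z D]\<close>; its first column carries neither the factor \<open>- z\<close> nor an
  identity part.
\<close>

definition pencil :: "complex mat \<Rightarrow> complex \<Rightarrow> complex mat" where
  "pencil W z = mat (dim_row W) (dim_row W)
     (\<lambda>(i, j). if j = 0 then W $$ (i, j) else (if i = j then 1 else 0) - z * W $$ (i, j))"

text \<open>
  The determinants of \<open>pencil W z\<close> and of \<open>I - z D\<close>, as polynomials in \<open>z\<close>.
\<close>

definition num_poly :: "complex mat \<Rightarrow> complex poly" where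
  "num_poly W = det (mat (dim_row W) (dim_row W)
     (\<lambda>(i, j). if j = 0 then [:W $$ (i, j):] else [:if i = j then 1 else 0, - W $$ (i, j):]))"

definition den_poly :: "complex mat \<Rightarrow> complex poly" where
  "den_poly W = det (mat (dim_row W - 1) (dim_row W - 1)
     (\<lambda>(i, j). [:if i = j then 1 else 0, - W $$ (Suc i, Suc j):]))"

lemma pencil_carrier [simp]: "W \<in> carrier_mat n n \<Longrightarrow> pencil W z \<in> carrier_mat n n"
  by (auto simp: pencil_def)

lemma resolvent_carrier [simp]:
  "W \<in> carrier_mat (Suc m) (Suc m) \<Longrightarrow> 1\<^sub>m m - z \<cdot>\<^sub>m state_block W \<in> carrier_mat m m"
  by (auto intro!: minus_carrier_mat)

lemma poly_num_poly:
  assumes "W \<in> carrier_mat n n"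
  shows "poly (num_poly W) z = det (pencil W z)"
  unfolding num_poly_def
  by (rule poly_det_cong[of _ n]) (use assms in \<open>auto simp: pencil_def\<close>)

lemma poly_den_poly:
  assumes "W \<in> carrier_mat (Suc m) (Suc m)"
  shows "poly (den_poly W) z = det (1\<^sub>m m - z \<cdot>\<^sub>m state_block W)"
  unfolding den_poly_def
  by (rule poly_det_cong[of _ m]) (use assms in auto)

lemma den_poly_0 [simp]:
  assumes "W \<in> carrier_mat (Suc m) (Suc m)"
  shows "poly (den_poly W) 0 = 1"
proof -
  have "1\<^sub>m m - 0 \<cdot>\<^sub>m state_block W = 1\<^sub>m m" using assms by (intro eq_matI) auto
  then show ?thesis using assms by (simp add: poly_den_poly)
qed

lemma den_poly_nonzero:
  assumes "W \<in> carrier_mat (Suc m) (Suc m)"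
  shows "den_poly W \<noteq> 0"
  using den_poly_0[OF assms] by auto

lemma pencil_four_block:
  assumes "W \<in> carrier_mat (Suc m) (Suc m)"
  shows "pencil W z = four_block_mat (mat 1 1 (\<lambda>ij. W $$ ij)) ((- z) \<cdot>\<^sub>m out_block W)
    (in_block W) (1\<^sub>m m - z \<cdot>\<^sub>m state_block W)"
  using assms
  by (intro eq_matI)
     (auto simp: pencil_def four_block_mat_def Let_def in_block_def out_block_def state_block_def
        not_less_eq less_Suc_eq_0_disj)

lemma det_pencil_schur_complement:
  assumes W: "W \<in> carrier_mat (Suc m) (Suc m)" and F: "F \<in> carrier_mat m m"
    and inv: "(1\<^sub>m m - z \<cdot>\<^sub>m state_block W) * F = 1\<^sub>m m"
  shows "det (pencil W z) = det (1\<^sub>m m - z \<cdot>\<^sub>m state_block W) *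
    (mat 1 1 (\<lambda>ij. W $$ ij) + z \<cdot>\<^sub>m (out_block W * F * in_block W)) $$ (0, 0)"
proof -
  let ?A = "mat 1 1 (\<lambda>ij. W $$ ij) :: complex mat" and ?B = "out_block W" and ?C = "in_block W"
  let ?E = "1\<^sub>m m - z \<cdot>\<^sub>m state_block W"
  note c = block_carriers[OF W]
  have A: "?A \<in> carrier_mat 1 1" by simp
  have E: "?E \<in> carrier_mat m m" using W by (rule resolvent_carrier)
  have zB: "(- z) \<cdot>\<^sub>m ?B \<in> carrier_mat 1 m" using c by auto
  have FC: "F * ?C \<in> carrier_mat m 1" using F c(2) by (rule mult_carrier_mat)
  have mFC: "(-1) \<cdot>\<^sub>m (F * ?C) \<in> carrier_mat m 1" using FC by simp
  \<comment> \<open>block column elimination: right multiplication by \<open>?R\<close> clears the block \<open>C\<close>\<close>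
  let ?R = "four_block_mat (1\<^sub>m 1) (0\<^sub>m 1 m) ((-1) \<cdot>\<^sub>m (F * ?C)) (1\<^sub>m m)"
  have R: "?R \<in> carrier_mat (Suc m) (Suc m)" using four_block_carrier_mat[of "1\<^sub>m 1" 1 1 "1\<^sub>m m" m m] by simp
  have detR: "det ?R = 1"
    by (subst det_four_block_mat_upper_right_zero[OF one_carrier_mat refl mFC one_carrier_mat]) simp
  let ?T = "?A + z \<cdot>\<^sub>m (?B * F * ?C)"
  have lower: "?C + ?E * ((-1) \<cdot>\<^sub>m (F * ?C)) = 0\<^sub>m m 1"
  proof -
    have "?E * ((-1) \<cdot>\<^sub>m (F * ?C)) = (-1) \<cdot>\<^sub>m (?E * (F * ?C))"
      by (rule mult_smult_distrib[OF E FC])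
    also have "?E * (F * ?C) = ?E * F * ?C" by (rule assoc_mult_mat[OF E F c(2), symmetric])
    also have "\<dots> = ?C" unfolding inv by (rule left_mult_one_mat[OF c(2)])
    finally show ?thesis using c by (intro eq_matI) auto
  qed
  have upper: "?A + ((- z) \<cdot>\<^sub>m ?B) * ((-1) \<cdot>\<^sub>m (F * ?C)) = ?T"
  proof -
    have "((- z) \<cdot>\<^sub>m ?B) * ((-1) \<cdot>\<^sub>m (F * ?C)) = (-1) \<cdot>\<^sub>m ((- z) \<cdot>\<^sub>m (?B * (F * ?C)))"
      by (simp only: mult_smult_distrib[OF zB FC] mult_smult_assoc_mat[OF c(1) FC])
    also have "?B * (F * ?C) = ?B * F * ?C" by (rule assoc_mult_mat[OF c(1) F c(2), symmetric])
    also have "(-1) \<cdot>\<^sub>m ((- z) \<cdot>\<^sub>m (?B * F * ?C)) = z \<cdot>\<^sub>m (?B * F * ?C)"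
      by (intro eq_matI) auto
    finally show ?thesis by simp
  qed
  have T: "?T \<in> carrier_mat 1 1" using c by (auto simp del: One_nat_def)
  have "pencil W z * ?R = four_block_mat (?A * 1\<^sub>m 1 + ((- z) \<cdot>\<^sub>m ?B) * ((-1) \<cdot>\<^sub>m (F * ?C)))
     (?A * 0\<^sub>m 1 m + ((- z) \<cdot>\<^sub>m ?B) * 1\<^sub>m m) (?C * 1\<^sub>m 1 + ?E * ((-1) \<cdot>\<^sub>m (F * ?C)))
     (?C * 0\<^sub>m 1 m + ?E * 1\<^sub>m m)"
    unfolding pencil_four_block[OF W]
    by (rule mult_four_block_mat[OF A zB c(2) E one_carrier_mat zero_carrier_mat mFC one_carrier_mat])
  also have "?A * 1\<^sub>m 1 = ?A" by (rule right_mult_one_mat[OF A])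
  also have "?C * 1\<^sub>m 1 = ?C" by (rule right_mult_one_mat[OF c(2)])
  also have "?C * 0\<^sub>m 1 m + ?E * 1\<^sub>m m = ?E"
    using c E W by simp
  finally have prod: "pencil W z * ?R = four_block_mat ?T (?A * 0\<^sub>m 1 m + ((- z) \<cdot>\<^sub>m ?B) * 1\<^sub>m m) (0\<^sub>m m 1) ?E"
    by (simp only: lower upper)
  have X: "?A * 0\<^sub>m 1 m + ((- z) \<cdot>\<^sub>m ?B) * 1\<^sub>m m \<in> carrier_mat 1 m"
    by (intro add_carrier_mat mult_carrier_mat[OF zB] one_carrier_mat)
  have "det (pencil W z) = det (pencil W z * ?R)"
    using det_mult[OF pencil_carrier[OF W] R] detR by simp
  also have "\<dots> = det ?T * det ?E"
    unfolding prod by (rule det_four_block_mat_lower_left_zero[OF T X refl E])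
  finally show ?thesis using det_single[OF T] by simp
qed

lemma invertible_mat_iff_det:
  fixes E :: "complex mat"
  assumes E: "E \<in> carrier_mat m m"
  shows "invertible_mat E \<longleftrightarrow> det E \<noteq> 0"
proof
  assume "invertible_mat E"
  then obtain B where B: "E * B = 1\<^sub>m m" "B * E = 1\<^sub>m (dim_row B)"
    using E by (auto simp: invertible_mat_def inverts_mat_def)
  have "dim_col B = m" using arg_cong[OF B(1), of dim_col] by simp
  moreover have "dim_row B = m" using arg_cong[OF B(2), of dim_col] E by simp
  ultimately have "B \<in> carrier_mat m m" by auto
  then have "det E * det B = 1" using B(1) det_mult[OF E] by (metis det_one)
  then show "det E \<noteq> 0" by auto
next
  assume "det E \<noteq> 0"
  then have "E \<in> Units (ring_mat TYPE(complex) m ())" by (rule det_non_zero_imp_unit[OF E])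
  then obtain B where "mat_inverse E = Some B"
    using mat_inverse(1)[OF E, of "()"] by (cases "mat_inverse E") auto
  from mat_inverse(2)[OF E this] show "invertible_mat E"
    using E by (auto simp: invertible_mat_def inverts_mat_def)
qed

lemma mat_inverse_of_det:
  fixes E :: "complex mat"
  assumes E: "E \<in> carrier_mat m m" and "det E \<noteq> 0"
  shows "the (mat_inverse E) \<in> carrier_mat m m" "E * the (mat_inverse E) = 1\<^sub>m m"
proof -
  have "E \<in> Units (ring_mat TYPE(complex) m ())" using assms by (rule det_non_zero_imp_unit)
  then obtain B where "mat_inverse E = Some B"
    using mat_inverse(1)[OF E, of "()"] by (cases "mat_inverse E") auto
  with mat_inverse(2)[OF E this]
  show "the (mat_inverse E) \<in> carrier_mat m m" "E * the (mat_inverse E) = 1\<^sub>m m" by auto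
qed

text \<open>
  The predicate \<open>represents\<close> only constrains points at which \<open>I - z D\<close> is invertible, that is, at
  which \<open>den_poly W\<close> does not vanish.
\<close>

lemma represents_iff_eval:
  assumes W: "W \<in> carrier_mat (Suc m) (Suc m)"
  shows "represents W f \<longleftrightarrow> (\<forall>z. poly (den_poly W) z \<noteq> 0 \<longrightarrow>
    ratfun_eval f z = poly (num_poly W) z / poly (den_poly W) z)"
proof -
  have dim: "dim_row (state_block W) = m" using block_carriers[OF W] by auto
  have "(mat 1 1 (\<lambda>ij. W $$ ij) + z \<cdot>\<^sub>m (out_block W *
      the (mat_inverse (1\<^sub>m m - z \<cdot>\<^sub>m state_block W)) * in_block W)) $$ (0, 0)
    = poly (num_poly W) z / poly (den_poly W) z" if nz: "poly (den_poly W) z \<noteq> 0" for z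
    using det_pencil_schur_complement[OF W mat_inverse_of_det[OF resolvent_carrier[OF W]]] nz
    unfolding poly_den_poly[OF W] poly_num_poly[OF W] by (simp add: field_simps)
  then show ?thesis
    unfolding represents_def split_block_eq prod.case dim
      invertible_mat_iff_det[OF resolvent_carrier[OF W]] poly_den_poly[OF W, symmetric]
    by auto
qed

lemma ratfun_eval_fract:
  assumes "poly Q z \<noteq> 0"
  shows "ratfun_eval (to_fract P / to_fract Q) z = poly P z / poly Q z"
proof -
  let ?f = "to_fract P / to_fract Q"
  obtain p q where pq: "quot_of_fract ?f = (p, q)" by (cases "quot_of_fract ?f")
  have q: "q \<noteq> 0" and f: "?f = Fract p q" and cop: "coprime p q"
    using snd_quot_of_fract_nonzero[of ?f] Fract_quot_of_fract[of ?f] coprime_quot_of_fract[of ?f] pq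
    by simp_all
  have Q: "Q \<noteq> 0" using assms by auto
  have "to_fract P / to_fract Q = Fract P Q" by (simp add: Fract_conv_to_fract)
  then have eq: "P * q = p * Q" using f q Q by (simp add: eq_fract)
  \<comment> \<open>the denominator in lowest terms divides every other denominator, so \<open>z\<close> is not a pole\<close>
  then have "q dvd p * Q" by (metis dvd_triv_right)
  then have "q dvd Q" using cop by (simp add: coprime_dvd_mult_right_iff coprime_commute)
  then have qz: "poly q z \<noteq> 0" using assms by (auto elim!: dvdE)
  have "poly P z * poly q z = poly p z * poly Q z"
    using arg_cong[OF eq, of "\<lambda>r. poly r z"] by simp
  then show ?thesis using qz assms by (simp add: ratfun_eval_def pq field_simps)
qed

lemma ratfun_eqI:
  assumes "Q \<noteq> 0" "\<And>z. poly Q z \<noteq> 0 \<Longrightarrow> ratfun_eval f z = poly P z / poly Q z"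
  shows "f = to_fract P / to_fract Q"
proof -
  obtain p q where pq: "quot_of_fract f = (p, q)" by (cases "quot_of_fract f")
  have q: "q \<noteq> 0" and f: "f = Fract p q"
    using snd_quot_of_fract_nonzero[of f] Fract_quot_of_fract[of f] pq by simp_all
  \<comment> \<open>the extra factor \<open>q * Q\<close> makes the identity hold at the excluded points as well\<close>
  have "poly (p * Q * (q * Q)) z = poly (P * q * (q * Q)) z" for z
  proof (cases "poly q z = 0 \<or> poly Q z = 0")
    case False
    then have "poly p z / poly q z = poly P z / poly Q z"
      using assms(2)[of z] by (simp add: ratfun_eval_def pq)
    then show ?thesis using False by (simp add: field_simps)
  qed auto
  then have "p * Q * (q * Q) = P * q * (q * Q)" by (simp add: poly_eq_poly_eq_iff[symmetric] fun_eq_iff)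
  then have "p * Q = P * q" using q assms(1) by simp
  then show ?thesis using f q assms(1) by (simp add: Fract_conv_to_fract[symmetric] eq_fract)
qed

text \<open>
  The pointwise representation property is an identity of rational functions, as infinitely many
  points are not excluded.
\<close>

lemma represents_iff_fract:
  assumes W: "W \<in> carrier_mat (Suc m) (Suc m)"
  shows "represents W f \<longleftrightarrow> f = to_fract (num_poly W) / to_fract (den_poly W)"
  unfolding represents_iff_eval[OF W]
  using ratfun_eqI[OF den_poly_nonzero[OF W]] ratfun_eval_fract by auto

lemma num_poly_0:
  assumes W: "W \<in> carrier_mat (Suc m) (Suc m)"
  shows "poly (num_poly W) 0 = W $$ (0, 0)"
proof -
  have E: "1\<^sub>m m - 0 \<cdot>\<^sub>m state_block W = 1\<^sub>m m" using W by (intro eq_matI) auto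
  have "det (pencil W 0) = 1 * W $$ (0, 0)"
    using det_pencil_schur_complement[OF W one_carrier_mat, of 0] W E by simp
  then show ?thesis using W by (simp add: poly_num_poly)
qed

lemma represents_eval_0:
  assumes W: "W \<in> carrier_mat (Suc m) (Suc m)" and "represents W f"
  shows "ratfun_eval f 0 = W $$ (0, 0)"
  using assms ratfun_eval_fract[of "den_poly W" 0 "num_poly W"] num_poly_0[OF W] den_poly_0[OF W]
  by (simp add: represents_iff_fract)

section \<open>One step of the Schur algorithm\<close>

lemma special_entry_real:
  assumes "special_hessenberg W" "j + 1 < dim_row W"
  shows "W $$ (j, j + 1) = complex_of_real (Re (W $$ (j, j + 1)))" "0 \<le> Re (W $$ (j, j + 1))"
proof -
  have "0 \<le> W $$ (j, j + 1)" using assms by (auto simp: special_hessenberg_def)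
  then show "W $$ (j, j + 1) = complex_of_real (Re (W $$ (j, j + 1)))" "0 \<le> Re (W $$ (j, j + 1))"
    by (auto simp: less_eq_complex_def complex_eq_iff)
qed

lemma colligation_step_carrier [simp]:
  assumes "W \<in> carrier_mat (Suc (Suc k)) (Suc (Suc k))"
  shows "colligation_step c W \<in> carrier_mat (Suc k) (Suc k)"
  using assms unfolding colligation_step_def split_block_eq prod.case
  by (auto simp: split_block_def Let_def)

lemma colligation_step_index:
  assumes W: "W \<in> carrier_mat (Suc (Suc k)) (Suc (Suc k))" and "i < Suc k" "j < Suc k"
  shows "colligation_step c W $$ (i, j) =
    (if j = 0 then schur_factor c * W $$ (Suc i, 0) else W $$ (Suc i, Suc j))"
proof -
  have *: "split_block M 1 1 = (mat 1 1 (\<lambda>ij. M $$ ij), mat 1 (dim_col M - 1) (\<lambda>(i, j). M $$ (i, j + 1)),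
    mat (dim_row M - 1) 1 (\<lambda>(i, j). M $$ (i + 1, j)),
    mat (dim_row M - 1) (dim_col M - 1) (\<lambda>(i, j). M $$ (i + 1, j + 1)))" for M :: "complex mat"
    by (simp only: split_block_def Let_def)
  show ?thesis
    using assms unfolding colligation_step_def split_block_eq prod.case *
    by (auto simp: four_block_mat_def Let_def in_block_def out_block_def state_block_def less_Suc_eq_0_disj)
qed

lemma cofactor_col0_cong:
  assumes "A \<in> carrier_mat n n" "B \<in> carrier_mat n n"
    and "\<And>i j. i < n \<Longrightarrow> Suc j < n \<Longrightarrow> A $$ (i, Suc j) = B $$ (i, Suc j)"
  shows "cofactor A i 0 = cofactor B i 0"
proof -
  have "mat_delete A i 0 = mat_delete B i 0"
    using assms by (intro eq_matI) (auto simp: mat_delete_def)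
  then show ?thesis by (simp add: cofactor_def)
qed

text \<open>
  The situation in which one step of the recursion is performed: \<open>W\<close> has state dimension \<open>k + 1\<close>, and
  the reduced matrix, written \<open>W'\<close> below, has state dimension \<open>k\<close>. The first row of \<open>W\<close> is
  \<open>(c, b, 0, \<dots>, 0)\<close>.
\<close>

locale hessenberg_colligation =
  fixes k :: nat and W :: "complex mat"
  assumes carrier: "W \<in> carrier_mat (Suc (Suc k)) (Suc (Suc k))"
    and unitary: "unitary_mat W"
    and hess: "lower_hessenberg W"
    and special: "special_hessenberg W"
    and HL: "HL_nonsingular W"
begin

abbreviation c :: complex where "c \<equiv> W $$ (0, 0)"

definition b :: real where "b = Re (W $$ (0, 1))"

lemma W01: "W $$ (0, Suc 0) = complex_of_real b"
  using special_entry_real(1)[OF special, of 0] carrier by (simp add: b_def)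

lemma b_pos: "b > 0"
proof -
  have "W $$ (0, Suc 0) \<noteq> 0" using HL carrier by (auto simp: HL_nonsingular_def)
  then have "b \<noteq> 0" by (simp add: W01)
  moreover have "b \<ge> 0"
    using special_entry_real(2)[OF special, of 0] carrier by (simp add: b_def)
  ultimately show ?thesis by simp
qed

lemma row0: "2 \<le> j \<Longrightarrow> j < Suc (Suc k) \<Longrightarrow> W $$ (0, j) = 0"
  using hess carrier by (auto simp: lower_hessenberg_def)

lemma row0_product:
  assumes "i < Suc (Suc k)"
  shows "cnj c * W $$ (i, 0) + of_real b * W $$ (i, Suc 0) = (if i = 0 then 1 else 0)"
proof -
  have "(\<Sum>l<Suc (Suc k). W $$ (i, l) * cnj (W $$ (0, l)))
     = W $$ (i, 0) * cnj c + W $$ (i, Suc 0) * cnj (W $$ (0, Suc 0))"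
    using row0 by (simp add: sum.lessThan_Suc_shift del: sum.lessThan_Suc)
  then show ?thesis
    using unitary_mat_rows[OF carrier unitary assms, of 0] by (simp add: W01 mult.commute)
qed

lemma b_sq: "complex_of_real b ^ 2 = 1 - c * cnj c"
  using row0_product[of 0] by (simp add: W01 power2_eq_square algebra_simps)

lemma schur_factor_eq: "schur_factor c = 1 / complex_of_real b"
proof -
  have "complex_of_real (b ^ 2) = complex_of_real (1 - (cmod c)\<^sup>2)"
    using b_sq by (simp add: complex_norm_square[symmetric] del: of_real_power add: of_real_power[symmetric])
  then have "b ^ 2 = 1 - (cmod c)\<^sup>2" using of_real_eq_iff by blast
  then have "(1 - (cmod c)\<^sup>2) powr (- 1 / 2) = (b powr 2) powr (- 1 / 2)"
    using b_pos by (simp add: powr_numeral)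
  also have "\<dots> = 1 / b" using b_pos by (simp add: powr_powr powr_minus inverse_eq_divide)
  finally show ?thesis by (simp add: schur_factor_def)
qed

abbreviation W' :: "complex mat" where "W' \<equiv> colligation_step c W"

lemma W'_carrier: "W' \<in> carrier_mat (Suc k) (Suc k)"
  using carrier by simp

lemma W'_dims [simp]: "dim_row W' = Suc k" "dim_col W' = Suc k"
  using W'_carrier by auto

lemma W'_index:
  assumes "i < Suc k" "j < Suc k"
  shows "W' $$ (i, j) = (if j = 0 then W $$ (Suc i, 0) / of_real b else W $$ (Suc i, Suc j))"
  using colligation_step_index[OF carrier assms] by (simp add: schur_factor_eq)

lemma W'_hess: "lower_hessenberg W'"
  using W'_carrier hess carrier by (auto simp: lower_hessenberg_def W'_index)

lemma W'_special: "special_hessenberg W'"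
  using W'_carrier special carrier by (auto simp: special_hessenberg_def W'_index)

lemma W'_HL: "HL_nonsingular W'"
  using W'_carrier HL carrier by (auto simp: HL_nonsingular_def W'_index)

lemma W'_unitary: "unitary_mat W'"
proof (rule unitary_matI_cols[OF W'_carrier])
  fix i j assume ij: "i < Suc k" "j < Suc k"
  \<comment> \<open>column \<open>j\<close> of the reduced matrix is \<open>r j\<close> times column \<open>\<sigma> j\<close> of \<open>W\<close> without its top entry\<close>
  define \<sigma> where "\<sigma> l = (if l = 0 then 0 else Suc l)" for l :: nat
  define r where "r l = (if l = 0 then 1 / complex_of_real b else 1)" for l :: nat
  have r_real: "cnj (r l) = r l" for l by (simp add: r_def)
  have \<sigma>: "\<sigma> i < Suc (Suc k)" "\<sigma> j < Suc (Suc k)" using ij by (auto simp: \<sigma>_def)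
  have W'_eq: "W' $$ (l, j) = r j * W $$ (Suc l, \<sigma> j)" if "l < Suc k" "j < Suc k" for l j
    using that by (simp add: W'_index r_def \<sigma>_def)
  have "(\<Sum>l<Suc k. cnj (W' $$ (l, i)) * W' $$ (l, j))
    = r i * r j * (\<Sum>l<Suc k. cnj (W $$ (Suc l, \<sigma> i)) * W $$ (Suc l, \<sigma> j))"
    unfolding sum_distrib_left
    using ij by (intro sum.cong) (auto simp: W'_eq r_real)
  also have "(\<Sum>l<Suc k. cnj (W $$ (Suc l, \<sigma> i)) * W $$ (Suc l, \<sigma> j))
    = (if \<sigma> i = \<sigma> j then 1 else 0) - cnj (W $$ (0, \<sigma> i)) * W $$ (0, \<sigma> j)"
    using unitary_mat_cols[OF carrier unitary \<sigma>] unfolding sum.lessThan_Suc_shift[of _ "Suc k"]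
    by (simp add: algebra_simps)
  also have "r i * r j * \<dots> = (if i = j then 1 else 0)"
  proof (cases "i = 0 \<and> j = 0")
    case True
    have "1 - cnj c * c = complex_of_real b ^ 2" using b_sq by (simp add: mult.commute)
    then show ?thesis using True b_pos by (simp add: \<sigma>_def r_def power2_eq_square)
  next
    case False
    then have "cnj (W $$ (0, \<sigma> i)) * W $$ (0, \<sigma> j) = 0"
      using row0[of "\<sigma> i"] row0[of "\<sigma> j"] \<sigma> by (auto simp: \<sigma>_def)
    then show ?thesis using False by (auto simp: \<sigma>_def r_def)
  qed
  finally show "(\<Sum>l<Suc k. cnj (W' $$ (l, i)) * W' $$ (l, j)) = (if i = j then 1 else 0)" .
qed

text \<open>
  Below the first row of \<open>W\<close>, its second column is \<open>- cnj c / b\<close> times its first column. So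
  \<open>I - z D\<close> and \<open>pencil W' z\<close> differ only in the first column, where the former is the first unit
  vector plus \<open>z cnj c\<close> times the latter.
\<close>

lemma den_step:
  "det (1\<^sub>m (Suc k) - z \<cdot>\<^sub>m state_block W) =
   det (1\<^sub>m k - z \<cdot>\<^sub>m state_block W') + z * cnj c * det (pencil W' z)"
proof -
  let ?M = "1\<^sub>m (Suc k) - z \<cdot>\<^sub>m state_block W" and ?P = "pencil W' z"
  have M: "?M \<in> carrier_mat (Suc k) (Suc k)" using carrier by (rule resolvent_carrier)
  have P: "?P \<in> carrier_mat (Suc k) (Suc k)" using W'_carrier by (rule pencil_carrier)
  have cof: "cofactor ?M i 0 = cofactor ?P i 0" for i
    by (rule cofactor_col0_cong[OF M P]) (use W'_carrier carrier in \<open>auto simp: pencil_def W'_index\<close>)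
  have col0: "?M $$ (i, 0) = (if i = 0 then 1 else 0) + z * cnj c * ?P $$ (i, 0)" if "i < Suc k" for i
  proof -
    have "W $$ (Suc i, Suc 0) = - cnj c * W $$ (Suc i, 0) / of_real b"
      using row0_product[of "Suc i"] that b_pos
      by (simp add: field_simps eq_neg_iff_add_eq_0 add.commute)
    then show ?thesis using that W'_carrier carrier by (simp add: pencil_def W'_index)
  qed
  have del: "mat_delete ?P 0 0 = 1\<^sub>m k - z \<cdot>\<^sub>m state_block W'"
    using W'_carrier by (intro eq_matI) (auto simp: mat_delete_def pencil_def)
  have "det ?M = (\<Sum>i<Suc k. ?M $$ (i, 0) * cofactor ?M i 0)"
    by (rule laplace_expansion_column[OF M]) simp
  also have "\<dots> = (\<Sum>i<Suc k. (if i = 0 then cofactor ?P i 0 else 0)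
      + z * cnj c * (?P $$ (i, 0) * cofactor ?P i 0))"
    by (intro sum.cong) (auto simp: cof col0 algebra_simps)
  also have "\<dots> = cofactor ?P 0 0 + z * cnj c * (\<Sum>i<Suc k. ?P $$ (i, 0) * cofactor ?P i 0)"
    by (simp add: sum.distrib sum_distrib_left del: sum.lessThan_Suc)
  also have "(\<Sum>i<Suc k. ?P $$ (i, 0) * cofactor ?P i 0) = det ?P"
    by (rule laplace_expansion_column[OF P, symmetric]) simp
  also have "cofactor ?P 0 0 = det (1\<^sub>m k - z \<cdot>\<^sub>m state_block W')"
    by (simp add: cofactor_def del)
  finally show ?thesis .
qed

text \<open>
  Expansion along the first row \<open>(c, - z b, 0, \<dots>, 0)\<close> of the pencil. Its second minor is, up to the
  factor \<open>b\<close> in the first column, the pencil of the reduced matrix.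
\<close>

lemma num_step:
  "det (pencil W z) = c * det (1\<^sub>m k - z \<cdot>\<^sub>m state_block W') + z * det (pencil W' z)"
proof -
  let ?T = "pencil W z" and ?P = "pencil W' z"
  have T: "?T \<in> carrier_mat (Suc (Suc k)) (Suc (Suc k))" using carrier by (rule pencil_carrier)
  have P: "?P \<in> carrier_mat (Suc k) (Suc k)" using W'_carrier by (rule pencil_carrier)
  let ?Q = "mat_delete ?T 0 1"
  have Q: "?Q \<in> carrier_mat (Suc k) (Suc k)" using mat_delete_carrier[OF T, of 0 1] by simp
  have detQ: "det ?Q = of_real b * det ?P"
  proof -
    have cof: "cofactor ?Q i 0 = cofactor ?P i 0" for i
      by (rule cofactor_col0_cong[OF Q P])
        (use W'_carrier carrier in \<open>auto simp: pencil_def W'_index mat_delete_def\<close>)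
    have "det ?Q = (\<Sum>i<Suc k. ?Q $$ (i, 0) * cofactor ?Q i 0)"
      by (rule laplace_expansion_column[OF Q]) simp
    also have "\<dots> = (\<Sum>i<Suc k. of_real b * (?P $$ (i, 0) * cofactor ?P i 0))"
    proof (rule sum.cong[OF refl])
      fix i assume "i \<in> {..<Suc k}"
      then have "?Q $$ (i, 0) = of_real b * ?P $$ (i, 0)"
        using carrier b_pos by (simp add: pencil_def W'_index mat_delete_def)
      then show "?Q $$ (i, 0) * cofactor ?Q i 0 = of_real b * (?P $$ (i, 0) * cofactor ?P i 0)"
        by (simp only: cof mult.assoc)
    qed
    also have "\<dots> = of_real b * det ?P"
      using laplace_expansion_column[OF P, of 0] by (simp add: sum_distrib_left del: sum.lessThan_Suc)
    finally show ?thesis .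
  qed
  have del: "mat_delete ?T 0 0 = 1\<^sub>m (Suc k) - z \<cdot>\<^sub>m state_block W"
    using carrier by (intro eq_matI) (auto simp: mat_delete_def pencil_def)
  have "det ?T = (\<Sum>j<Suc (Suc k). ?T $$ (0, j) * cofactor ?T 0 j)"
    by (rule laplace_expansion_row[OF T]) simp
  also have "\<dots> = ?T $$ (0, 0) * cofactor ?T 0 0 + ?T $$ (0, 1) * cofactor ?T 0 1"
    using carrier row0 by (simp add: sum.lessThan_Suc_shift pencil_def del: sum.lessThan_Suc)
  also have "\<dots> = c * det (1\<^sub>m (Suc k) - z \<cdot>\<^sub>m state_block W) + z * of_real b ^ 2 * det ?P"
  proof -
    have "?T $$ (0, 0) = c" "?T $$ (0, 1) = - z * of_real b"
      using carrier by (simp_all add: pencil_def W01)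
    moreover have "cofactor ?T 0 0 = det (1\<^sub>m (Suc k) - z \<cdot>\<^sub>m state_block W)"
      by (simp add: cofactor_def del)
    moreover have "cofactor ?T 0 1 = - (of_real b * det ?P)"
      using detQ by (simp add: cofactor_def)
    ultimately show ?thesis by (simp only: power2_eq_square) simp
  qed
  also have "\<dots> = c * det (1\<^sub>m k - z \<cdot>\<^sub>m state_block W') + z * det ?P"
    unfolding den_step b_sq by (simp add: algebra_simps)
  finally show ?thesis .
qed

lemma poly_step:
  "den_poly W = den_poly W' + [:0, cnj c:] * num_poly W'"
  "num_poly W = [:c:] * den_poly W' + [:0, 1:] * num_poly W'"
  using den_step num_step
  by (simp_all add: poly_eq_poly_eq_iff[symmetric] fun_eq_iff poly_den_poly[OF carrier]
      poly_num_poly[OF carrier] poly_den_poly[OF W'_carrier] poly_num_poly[OF W'_carrier])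

lemma represents_step:
  assumes "represents W f"
  shows "represents W' (schur_step f)"
proof -
  let ?h = "to_fract :: complex poly \<Rightarrow> ratfun"
  define N D where "N = ?h (num_poly W')" and "D = ?h (den_poly W')"
  define Z C C' where "Z = ?h [:0, 1:]" and "C = ?h [:c:]" and "C' = ?h [:cnj c:]"
  have D: "D \<noteq> 0" using den_poly_nonzero[OF W'_carrier] by (simp add: D_def)
  have Z: "Z \<noteq> 0" by (simp add: Z_def)
  have zc: "[:0, cnj c:] = [:0, 1:] * [:cnj c:]" by simp
  have den: "?h (den_poly W) = D + Z * C' * N"
    unfolding poly_step(1) zc by (simp only: D_def Z_def C'_def N_def to_fract_add to_fract_mult)
  have num: "?h (num_poly W) = C * D + Z * N"
    unfolding poly_step(2) by (simp only: D_def Z_def C_def N_def to_fract_add to_fract_mult)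
  have den0: "D + Z * C' * N \<noteq> 0" using den_poly_nonzero[OF carrier] den[symmetric] by simp
  have f: "f = (C * D + Z * N) / (D + Z * C' * N)"
    using assms represents_iff_fract[OF carrier] den num by simp
  \<comment> \<open>the constant \<open>1 - |c|\<^sup>2 = b\<^sup>2\<close> is non-zero also as a rational function\<close>
  have CC: "1 - C * C' \<noteq> 0"
  proof
    assume "1 - C * C' = 0"
    then have "?h 1 = ?h ([:c:] * [:cnj c:])" by (simp add: C_def C'_def del: mult_pCons_left mult_pCons_right)
    then have "c * cnj c = 1" by (simp del: to_fract_1 add: one_pCons mult.commute)
    then show False using b_sq b_pos by simp
  qed
  have 1: "f - C = Z * (1 - C * C') * N / (D + Z * C' * N)"
    unfolding f using den0 by (simp add: field_simps)
  have 2: "1 - f * C' = (1 - C * C') * D / (D + Z * C' * N)"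
    unfolding f using den0 by (simp add: field_simps)
  have "schur_step f = (1 / Z) * ((f - C) / (1 - f * C'))"
    using represents_eval_0[OF carrier assms]
    by (simp add: schur_step_def ratfun_const_def ratfun_id_def Let_def Z_def C_def C'_def)
  also have "\<dots> = N / D"
  proof -
    have "(1 / Z) * ((Z * K * N / E) / (K * D / E)) = N / D" if "K \<noteq> 0" "E \<noteq> 0" for K E
      using that Z by simp
    then show ?thesis unfolding 1 2 using CC den0 .
  qed
  finally show ?thesis
    using represents_iff_fract[OF W'_carrier] by (simp add: N_def D_def)
qed

lemma minimal: "minimal_mat W"
  using minimal_hessenberg_iff[OF carrier unitary hess] HL by simp

end

section \<open>Change of basis of the state space\<close>

lemma blocks_four_block_mat:
  assumes "A \<in> carrier_mat 1 1" "B \<in> carrier_mat 1 m" "C \<in> carrier_mat m 1" "D \<in> carrier_mat m m"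
  shows "out_block (four_block_mat A B C D) = B" "in_block (four_block_mat A B C D) = C"
    "state_block (four_block_mat A B C D) = D"
  using assms by (auto intro!: eq_matI simp: out_block_def in_block_def state_block_def)

lemma four_block_mat_split:
  assumes "W \<in> carrier_mat (Suc m) (Suc m)"
  shows "W = four_block_mat (mat 1 1 (\<lambda>ij. W $$ ij)) (out_block W) (in_block W) (state_block W)"
  using assms split_block(5)[OF split_block_eq[of W], of m m] by simp

text \<open>
  The block diagonal matrix \<open>diag(1, V)\<close>, acting on the state space only.
\<close>

definition state_change :: "nat \<Rightarrow> complex mat \<Rightarrow> complex mat" where
  "state_change m V = four_block_mat (1\<^sub>m 1) (0\<^sub>m 1 m) (0\<^sub>m m 1) V"

lemma state_change_carrier:
  "V \<in> carrier_mat m m \<Longrightarrow> state_change m V \<in> carrier_mat (Suc m) (Suc m)"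
  by (auto simp: state_change_def)

lemma det_state_change:
  assumes "V \<in> carrier_mat m m"
  shows "det (state_change m V) = det V"
  unfolding state_change_def
  using det_four_block_mat_upper_right_zero[OF one_carrier_mat refl zero_carrier_mat assms, of 1]
  by simp

lemma state_change_unitary:
  assumes V: "V \<in> carrier_mat m m" "unitary_mat V"
  shows "unitary_mat (state_change m V)"
proof (rule unitary_matI_cols[OF state_change_carrier[OF V(1)]])
  fix i j assume "i < Suc m" "j < Suc m"
  then show "(\<Sum>k<Suc m. cnj (state_change m V $$ (k, i)) * state_change m V $$ (k, j))
      = (if i = j then 1 else 0)"
    using V(1) unitary_mat_cols[OF V, of "i - 1" "j - 1"]
    unfolding sum.lessThan_Suc_shift
    by (cases i; cases j) (auto simp: state_change_def)
qed

lemma state_change_sandwich: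
  assumes A: "A \<in> carrier_mat 1 1" and B: "B \<in> carrier_mat 1 m"
    and C: "C \<in> carrier_mat m 1" and D: "D \<in> carrier_mat m m"
    and L: "L \<in> carrier_mat m m" and R: "R \<in> carrier_mat m m"
  shows "state_change m L * four_block_mat A B C D * state_change m R
    = four_block_mat A (B * R) (L * C) (L * D * R)"
proof -
  have LC: "L * C \<in> carrier_mat m 1" and LD: "L * D \<in> carrier_mat m m"
    and BR: "B * R \<in> carrier_mat 1 m" and LDR: "L * D * R \<in> carrier_mat m m"
    using mult_carrier_mat[OF L C] mult_carrier_mat[OF L D] mult_carrier_mat[OF B R]
      mult_carrier_mat[OF mult_carrier_mat[OF L D] R] by auto
  have 1: "state_change m L * four_block_mat A B C D = four_block_mat A B (L * C) (L * D)"
    unfolding state_change_def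
      mult_four_block_mat[OF one_carrier_mat zero_carrier_mat zero_carrier_mat L A B C D]
    by (intro cong_four_block_mat)
       (simp_all only: left_mult_one_mat[OF A] left_mult_one_mat[OF B] left_mult_zero_mat[OF A]
         left_mult_zero_mat[OF B] left_mult_zero_mat[OF C] left_mult_zero_mat[OF D]
         right_add_zero_mat[OF A] right_add_zero_mat[OF B] left_add_zero_mat[OF LC] left_add_zero_mat[OF LD])
  have 2: "four_block_mat A B (L * C) (L * D) * state_change m R = four_block_mat A (B * R) (L * C) (L * D * R)"
    unfolding state_change_def
      mult_four_block_mat[OF A B LC LD one_carrier_mat zero_carrier_mat zero_carrier_mat R]
    by (intro cong_four_block_mat)
       (simp_all only: right_mult_one_mat[OF A] right_mult_one_mat[OF LC] right_mult_zero_mat[OF A]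
         right_mult_zero_mat[OF B] right_mult_zero_mat[OF LC] right_mult_zero_mat[OF LD]
         right_add_zero_mat[OF A] right_add_zero_mat[OF LC] left_add_zero_mat[OF BR] left_add_zero_mat[OF LDR])
  show ?thesis unfolding 1 2 ..
qed

lemma det_sandwich:
  assumes "L \<in> carrier_mat n n" "M \<in> carrier_mat n n" "R \<in> carrier_mat n n"
    and "det L * det R = (1 :: 'a :: comm_ring_1)"
  shows "det (L * M * R) = det M"
proof -
  have "det (L * M * R) = (det L * det R) * det M"
    by (simp only: det_mult[OF mult_carrier_mat[OF assms(1,2)] assms(3)] det_mult[OF assms(1,2)]
        mult.assoc mult.commute[of "det M"])
  then show ?thesis unfolding assms(4) by simp
qed

text \<open>
  The colligation \<open>U\<close> in the state basis given by a unitary \<open>V\<close>, written \<open>T\<close> below.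
\<close>

locale unitary_state_change =
  fixes m :: nat and U V :: "complex mat"
  assumes U: "U \<in> carrier_mat (Suc m) (Suc m)"
    and V: "V \<in> carrier_mat m m" "unitary_mat V"
begin

definition T :: "complex mat" where
  "T = state_change m (mat_adjoint V) * U * state_change m V"

lemma V': "mat_adjoint V \<in> carrier_mat m m" "unitary_mat (mat_adjoint V)"
  using V unitary_mat_adjoint by auto

lemmas VV = unitary_mat_inverse[OF V]

lemma T_four_block:
  "T = four_block_mat (mat 1 1 (\<lambda>ij. U $$ ij)) (out_block U * V) (mat_adjoint V * in_block U)
    (mat_adjoint V * state_block U * V)"
proof -
  have A: "mat 1 1 (\<lambda>ij. U $$ ij) \<in> carrier_mat 1 1" by simp
  show ?thesis
    unfolding T_def
    using state_change_sandwich[OF A block_carriers[OF U] V'(1) V(1)] four_block_mat_split[OF U]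
    by simp
qed

lemma T_carrier: "T \<in> carrier_mat (Suc m) (Suc m)"
  using state_change_carrier[OF V(1)] state_change_carrier[OF V'(1)] U
  unfolding T_def by (meson mult_carrier_mat)

lemma T_blocks:
  "out_block T = out_block U * V" "in_block T = mat_adjoint V * in_block U"
  "state_block T = mat_adjoint V * state_block U * V" "T $$ (0, 0) = U $$ (0, 0)"
proof -
  note c = block_carriers[OF U]
  have A: "mat 1 1 (\<lambda>ij. U $$ ij) \<in> carrier_mat 1 1" by simp
  have X: "mat_adjoint V * state_block U * V \<in> carrier_mat m m"
    using mult_carrier_mat[OF mult_carrier_mat[OF V'(1) c(3)] V(1)] .
  show "out_block T = out_block U * V" "in_block T = mat_adjoint V * in_block U"
    "state_block T = mat_adjoint V * state_block U * V"
    unfolding T_four_block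
    using blocks_four_block_mat[OF A mult_carrier_mat[OF c(1) V(1)] mult_carrier_mat[OF V'(1) c(2)] X]
    by auto
  show "T $$ (0, 0) = U $$ (0, 0)"
    unfolding T_four_block using V by (simp add: four_block_mat_def Let_def)
qed

lemma T_unitary:
  assumes "unitary_mat U"
  shows "unitary_mat T"
proof -
  have L: "state_change m (mat_adjoint V) \<in> carrier_mat (Suc m) (Suc m)"
      "unitary_mat (state_change m (mat_adjoint V))"
    and R: "state_change m V \<in> carrier_mat (Suc m) (Suc m)" "unitary_mat (state_change m V)"
    using state_change_carrier state_change_unitary V V' by auto
  show ?thesis
    unfolding T_def
    by (rule unitary_mat_mult[OF mult_carrier_mat[OF L(1) U] unitary_mat_mult[OF L U assms] R])
qed

lemma T_resolvent:
  "1\<^sub>m m - z \<cdot>\<^sub>m state_block T = mat_adjoint V * (1\<^sub>m m - z \<cdot>\<^sub>m state_block U) * V"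
proof -
  note c = block_carriers[OF U]
  have zD: "z \<cdot>\<^sub>m state_block U \<in> carrier_mat m m" using c by simp
  have VD: "mat_adjoint V * state_block U \<in> carrier_mat m m" using V'(1) c(3) by (rule mult_carrier_mat)
  have "mat_adjoint V * (1\<^sub>m m - z \<cdot>\<^sub>m state_block U) * V
    = (mat_adjoint V - z \<cdot>\<^sub>m (mat_adjoint V * state_block U)) * V"
    by (simp only: mult_minus_distrib_mat[OF V'(1) one_carrier_mat zD] right_mult_one_mat[OF V'(1)]
        mult_smult_distrib[OF V'(1) c(3)])
  also have "\<dots> = mat_adjoint V * V - z \<cdot>\<^sub>m (mat_adjoint V * state_block U * V)"
    by (simp only: minus_mult_distrib_mat[OF V'(1) smult_carrier_mat[OF VD] V(1)]
        mult_smult_assoc_mat[OF VD V(1)])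
  finally show ?thesis by (simp only: T_blocks VV)
qed

lemma T_pencil: "pencil T z = state_change m (mat_adjoint V) * pencil U z * state_change m V"
proof -
  note c = block_carriers[OF U]
  have A: "mat 1 1 (\<lambda>ij. U $$ ij) \<in> carrier_mat 1 1" by simp
  have AT: "mat 1 1 (\<lambda>ij. T $$ ij) = mat 1 1 (\<lambda>ij. U $$ ij)"
    using T_blocks(4) by (intro eq_matI) auto
  show ?thesis
    unfolding pencil_four_block[OF T_carrier] pencil_four_block[OF U]
      state_change_sandwich[OF A smult_carrier_mat[OF c(1)] c(2) resolvent_carrier[OF U] V'(1) V(1)]
      T_resolvent AT T_blocks(1,2)
    by (simp only: mult_smult_assoc_mat[OF c(1) V(1)])
qed

lemma det_V: "det (mat_adjoint V) * det V = 1"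
proof -
  have "det (mat_adjoint V * V) = 1" using VV by simp
  then show ?thesis using det_mult[OF V'(1) V(1)] by simp
qed

lemma T_polys: "num_poly T = num_poly U" "den_poly T = den_poly U"
proof -
  have "det (pencil T z) = det (pencil U z)" for z
    unfolding T_pencil using det_V V V'
    by (intro det_sandwich[of _ "Suc m"])
       (auto simp: state_change_carrier det_state_change intro: pencil_carrier[OF U])
  moreover have "det (1\<^sub>m m - z \<cdot>\<^sub>m state_block T) = det (1\<^sub>m m - z \<cdot>\<^sub>m state_block U)" for z
    unfolding T_resolvent using det_V V V'
    by (intro det_sandwich[of _ m]) (auto intro: resolvent_carrier[OF U])
  ultimately show "num_poly T = num_poly U" "den_poly T = den_poly U"
    by (simp_all add: poly_eq_poly_eq_iff[symmetric] fun_eq_iff poly_den_poly[OF U]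
      poly_num_poly[OF U] poly_den_poly[OF T_carrier] poly_num_poly[OF T_carrier])
qed

lemma T_represents: "represents T f \<longleftrightarrow> represents U f"
  unfolding represents_iff_fract[OF T_carrier] represents_iff_fract[OF U] T_polys ..

lemma pow_conjugate:
  assumes D: "D \<in> carrier_mat m m"
  shows "(mat_adjoint V * D * V) ^\<^sub>m j = mat_adjoint V * D ^\<^sub>m j * V"
proof (induction j)
  case 0
  then show ?case using V V' VV by (simp add: right_mult_one_mat[OF V'(1)] carrier_matD[OF D])
next
  case (Suc j)
  let ?A = "mat_adjoint V" and ?P = "D ^\<^sub>m j"
  have P: "?P \<in> carrier_mat m m" using D by simp
  have "(?A * D * V) ^\<^sub>m Suc j = ?A * (?P * ((V * ?A) * (D * V)))"
    using V V' D P Suc by (simp add: assoc_mult_mat[of _ m m _ m _ m] mult_carrier_mat[of _ m m _ m])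
  also have "\<dots> = ?A * (?P * (D * V))"
    using D V by (simp add: VV left_mult_one_mat[OF mult_carrier_mat[OF D V(1)]])
  also have "\<dots> = ?A * D ^\<^sub>m Suc j * V"
    using V V' D P by (simp add: assoc_mult_mat[of _ m m _ m _ m] mult_carrier_mat[of _ m m _ m])
  finally show ?case .
qed

lemma krylov_conjugate:
  assumes D: "D \<in> carrier_mat m m" and C: "C \<in> carrier_mat m 1"
  shows "krylov_mat (mat_adjoint V * D * V) (mat_adjoint V * C) = mat_adjoint V * krylov_mat D C"
proof -
  let ?A = "mat_adjoint V"
  have ADV: "?A * D * V \<in> carrier_mat m m" and AC: "?A * C \<in> carrier_mat m 1"
    using mult_carrier_mat[OF mult_carrier_mat[OF V'(1) D] V(1)] mult_carrier_mat[OF V'(1) C] by auto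
  have K: "krylov_mat D C \<in> carrier_mat m m" and K': "krylov_mat (?A * D * V) (?A * C) \<in> carrier_mat m m"
    using krylov_mat_carrier D ADV by auto
  have col: "(?A * D * V) ^\<^sub>m j * (?A * C) = ?A * (D ^\<^sub>m j * C)" for j
  proof -
    have P: "D ^\<^sub>m j \<in> carrier_mat m m" using D by simp
    have AP: "?A * D ^\<^sub>m j \<in> carrier_mat m m" using V'(1) P by (rule mult_carrier_mat)
    have "?A * D ^\<^sub>m j * V * (?A * C) = ?A * D ^\<^sub>m j * (V * (?A * C))"
      by (rule assoc_mult_mat[OF AP V(1) AC])
    also have "V * (?A * C) = V * ?A * C" by (rule assoc_mult_mat[OF V(1) V'(1) C, symmetric])
    also have "\<dots> = C" unfolding VV by (rule left_mult_one_mat[OF C])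
    also have "?A * D ^\<^sub>m j * C = ?A * (D ^\<^sub>m j * C)" by (rule assoc_mult_mat[OF V'(1) P C])
    finally show ?thesis unfolding pow_conjugate[OF D] .
  qed
  show ?thesis
  proof (rule eq_matI, goal_cases)
    case (1 i j)
    then have ij: "i < m" "j < m"
      by (simp_all only: carrier_matD[OF mult_carrier_mat[OF V'(1) K]])
    have x: "D ^\<^sub>m j * C \<in> carrier_mat m 1" using D C by (intro mult_carrier_mat[of _ m m]) auto
    have "krylov_mat (?A * D * V) (?A * C) $$ (i, j) = (?A * (D ^\<^sub>m j * C)) $$ (i, 0)"
      using krylov_mat_index[OF ADV AC ij] col by simp
    also have "\<dots> = scalar_prod (Matrix.row ?A i) (col (D ^\<^sub>m j * C) 0)"
      using ij x V'(1) by (simp only: index_mult_mat(1) carrier_matD)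
    also have "col (D ^\<^sub>m j * C) 0 = col (krylov_mat D C) j"
    proof (rule eq_vecI)
      fix l assume "l < dim_vec (col (krylov_mat D C) j)"
      then have l: "l < m" using K by simp
      have "col (D ^\<^sub>m j * C) 0 $ l = (D ^\<^sub>m j * C) $$ (l, 0)"
        using l carrier_matD[OF x] by (intro index_col) simp_all
      also have "\<dots> = col (krylov_mat D C) j $ l"
        using l ij carrier_matD[OF K] krylov_mat_index[OF D C l ij(2)] by (simp only: index_col)
      finally show "col (D ^\<^sub>m j * C) 0 $ l = col (krylov_mat D C) j $ l" .
    qed (use carrier_matD[OF K] carrier_matD[OF x] in simp)
    also have "scalar_prod (Matrix.row ?A i) \<dots> = (?A * krylov_mat D C) $$ (i, j)"
      using ij K V'(1) by (simp only: index_mult_mat(1) carrier_matD)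
    finally show ?case .
  qed (simp_all only: carrier_matD[OF K'] carrier_matD[OF mult_carrier_mat[OF V'(1) K]])
qed

lemma T_minimal:
  assumes "unitary_mat U" "minimal_mat U"
  shows "minimal_mat T"
proof -
  note c = block_carriers[OF U]
  let ?D = "mat_adjoint (state_block U)" and ?C = "mat_adjoint (out_block U)"
  have D: "?D \<in> carrier_mat m m" and C: "?C \<in> carrier_mat m 1" using c by auto
  have "mat_adjoint (state_block T) = mat_adjoint V * ?D * V"
    unfolding T_blocks mat_adjoint_mult[OF mult_carrier_mat[OF V'(1) c(3)] V(1)]
      mat_adjoint_mult[OF V'(1) c(3)] mat_adjoint_adjoint
    by (rule assoc_mult_mat[OF V'(1) D V(1), symmetric])
  moreover have "mat_adjoint (out_block T) = mat_adjoint V * ?C"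
    unfolding T_blocks by (rule mat_adjoint_mult[OF c(1) V(1)])
  ultimately have "krylov_mat (mat_adjoint (state_block T)) (mat_adjoint (out_block T))
      = mat_adjoint V * krylov_mat ?D ?C"
    using krylov_conjugate[OF D C] by simp
  then have "det (krylov_mat (mat_adjoint (state_block T)) (mat_adjoint (out_block T)))
      = det (mat_adjoint V) * det (krylov_mat ?D ?C)"
    using det_mult[OF V'(1) krylov_mat_carrier[OF D]] by simp
  moreover have "det (mat_adjoint V) \<noteq> 0" using det_V by auto
  moreover have "det (krylov_mat ?D ?C) \<noteq> 0"
    using assms minimal_unitary_iff[OF U assms(1)] by blast
  ultimately show ?thesis
    using minimal_unitary_iff[OF T_carrier T_unitary[OF assms(1)]] by simp
qed

end

section \<open>Propagation along the Schur algorithm\<close>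

theorem mainTheorem6:
  fixes s :: ratfun and n :: nat and U V :: "complex mat" and Us :: "nat \<Rightarrow> complex mat"
  assumes inner: "rational_inner s"
    and deg: "ratfun_degree s = n"
    and n: "n \<ge> 1"
    and U: "U \<in> carrier_mat (n + 1) (n + 1)" "unitary_mat U" "minimal_mat U" "represents U s"
    and V: "V \<in> carrier_mat n n" "unitary_mat V"
    and U0: "Us 0 =
        four_block_mat (1\<^sub>m 1) (0\<^sub>m 1 n) (0\<^sub>m n 1) (mat_adjoint V) * U *
        four_block_mat (1\<^sub>m 1) (0\<^sub>m 1 n) (0\<^sub>m n 1) V"
    and U0_special: "lower_hessenberg (Us 0)" "special_hessenberg (Us 0)"
    and U_rec: "\<forall>p. p + 2 \<le> n \<longrightarrow> Us (p + 1) = colligation_step (schur_param s p) (Us p)"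
  shows "(\<forall>p<n. Us p \<in> carrier_mat (n - p + 1) (n - p + 1) \<and>
            unitary_mat (Us p) \<and> HL_nonsingular (Us p) \<and> lower_hessenberg (Us p) \<and>
            minimal_mat (Us p) \<and> represents (Us p) (schur_fun s p)) \<and>
         (case split_block (Us (n - 1)) 1 1 of (A, B, C, D) \<Rightarrow>
            schur_param s n = schur_factor (schur_param s (n - 1)) * C $$ (0, 0))"
proof -
  interpret sc: unitary_state_change n U V
    using U(1) V by unfold_locales simp_all
  have Us0: "Us 0 = sc.T" by (simp add: U0 sc.T_def state_change_def)
  have main: "hessenberg_colligation (n - p - 1) (Us p) \<and> represents (Us p) (schur_fun s p)"
    if "p < n" for p
    using that
  proof (induction p)
    case 0
    \<comment> \<open>minimality of the original colligation enters only here\<close>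
    have "HL_nonsingular (Us 0)"
      using minimal_hessenberg_iff[of "Us 0" n] U0_special(1) sc.T_carrier sc.T_unitary[OF U(2)]
        sc.T_minimal[OF U(2,3)] by (simp add: Us0)
    moreover have "represents (Us 0) (schur_fun s 0)"
      using U(4) by (simp add: Us0 sc.T_represents schur_fun_def)
    ultimately show ?case
      using U0_special sc.T_carrier sc.T_unitary[OF U(2)] n
      by (auto simp: hessenberg_colligation_def Us0)
  next
    case (Suc p)
    then interpret h: hessenberg_colligation "n - p - 1" "Us p" by simp
    have rep: "represents (Us p) (schur_fun s p)" using Suc by simp
    have "schur_param s p = h.c"
      using represents_eval_0[OF h.carrier rep] by (simp add: schur_param_def)
    then have Us: "Us (Suc p) = h.W'" using U_rec Suc.prems by auto
    have "schur_fun s (Suc p) = schur_step (schur_fun s p)" by (simp add: schur_fun_def)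
    then have "represents (Us (Suc p)) (schur_fun s (Suc p))"
      using h.represents_step[OF rep] by (simp add: Us)
    moreover have "n - p - 1 = Suc (n - Suc p - 1)" using Suc.prems by simp
    ultimately show ?case
      using h.W'_carrier h.W'_unitary h.W'_hess h.W'_special h.W'_HL
      by (simp add: hessenberg_colligation_def Us)
  qed
  have first: "Us p \<in> carrier_mat (n - p + 1) (n - p + 1) \<and>
      unitary_mat (Us p) \<and> HL_nonsingular (Us p) \<and> lower_hessenberg (Us p) \<and>
      minimal_mat (Us p) \<and> represents (Us p) (schur_fun s p)" if "p < n" for p
  proof -
    interpret h: hessenberg_colligation "n - p - 1" "Us p" using main[OF that] by simp
    have "n - p + 1 = Suc (Suc (n - p - 1))" using that by simp
    then show ?thesis
      using h.carrier h.unitary h.HL h.hess h.minimal main[OF that] by metis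
  qed
  \<comment> \<open>one further step turns the \<open>2 \<times> 2\<close> matrix \<open>Us (n - 1)\<close> into a \<open>1 \<times> 1\<close> matrix representing a constant\<close>
  have last: "schur_param s n = schur_factor (schur_param s (n - 1)) * in_block (Us (n - 1)) $$ (0, 0)"
  proof -
    have "n - 1 < n" using n by simp
    note m = main[OF this]
    interpret h: hessenberg_colligation 0 "Us (n - 1)" using m n by simp
    have rep: "represents (Us (n - 1)) (schur_fun s (n - 1))" using m by simp
    have c: "schur_param s (n - 1) = h.c"
      using represents_eval_0[OF h.carrier rep] by (simp add: schur_param_def)
    have "schur_fun s n = schur_step (schur_fun s (n - 1))"
      using n by (cases n) (auto simp: schur_fun_def)
    then have "schur_param s n = h.W' $$ (0, 0)"
      using represents_eval_0[OF h.W'_carrier h.represents_step[OF rep]] by (simp add: schur_param_def)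
    then show ?thesis
      using colligation_step_index[OF h.carrier, of 0 0] h.carrier unfolding c by (simp add: in_block_def)
  qed
  show ?thesis
  proof (rule conjI)
    show "\<forall>p<n. Us p \<in> carrier_mat (n - p + 1) (n - p + 1) \<and>
        unitary_mat (Us p) \<and> HL_nonsingular (Us p) \<and> lower_hessenberg (Us p) \<and>
        minimal_mat (Us p) \<and> represents (Us p) (schur_fun s p)"
      using first by (intro allI impI)
    show "case split_block (Us (n - 1)) 1 1 of (A, B, C, D) \<Rightarrow>
        schur_param s n = schur_factor (schur_param s (n - 1)) * C $$ (0, 0)"
      unfolding split_block_eq prod.case by (rule last)
  qed
qed

end
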